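(* For all graphs $G$ and $H$, $$\operatorname{tw}(G\,\square\, H)\geq \operatorname{sbn}(G)(\operatorname{tw}(H)+1)-1.$$
   Context: All graphs are simple, finite and undirected. A tree-decomposition of a graph $G$ is a pair $(T,\beta)$ consisting of a tree $T$ and a function $\beta:V(T)\to 2^{V(G)}$ such that (i) for every $v\in V(G)$, the set $\{t\in V(T): v\in\beta(t)\}$ is non-empty and induces a connected subgraph of $T$; and (ii) for every edge $uv\in E(G)$ there is $t\in V(T)$ with $\{u,v\}\subseteq\beta(t)$. Its width is $\max_{t\in V(T)}|\beta(t)|-1$. The treewidth $\operatorname{tw}(G)$ is the minimum width of a tree-decomposition of $G$. A set $A\subseteq V(G)$ is connected in $G$ if the induced subgraph $G[A]$ is connected. A strict bramble in $G$ is a collection $\mathscr{S}$ of non-empty connected subsets of $V(G)$ that pairwise intersect. A hitting set for $\mathscr{S}$ is a set $S\subseteq V(G)$ that intersects every element of $\mathscr{S}$; the order of $\mathscr{S}$ is the minimum size of a hitting set for $\mathscr{S}$. The strict bramble number $\operatorname{sbn}(G)$ is the maximum order of a strict bramble in $G$. The Cartesian product $G\,\square\, H$ is the graph with vertex set $V(G)\times V(H)$, where $(g_1,h_1)(g_2,h_2)$ is an edge if and only if $g_1=g_2$ and $h_1h_2\in E(H)$; or $g_1g_2\in E(G)$ and $h_1=h_2$. *)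

theory Defs
  imports "Graph_Theory.Graph_Theory"
begin

text \<open>
  Finite simple undirected graphs are the \<^locale>\<open>pair_graph\<close>s of the library: finite, loop-free,
  symmetric relations on an explicit (possibly empty) vertex set, each edge being represented by both
  of its orientations.
\<close>

text \<open>
  The library predicates \<^const>\<open>forest\<close> and \<^const>\<open>tree\<close> are unsuitable for symmetric digraphs:
  traversing an edge back and forth counts as a cycle of length 2 there. The cycles of a simple
  undirected graph are exactly the closed walks accepted by \<^const>\<open>pre_digraph.cycle\<close> that have length
  at least 3. A tree is non-empty, because \<^const>\<open>connected\<close> rejects the null graph.
\<close>

definition undirected_tree :: "'t pair_pre_digraph \<Rightarrow> bool" where
  "undirected_tree T \<longleftrightarrow>
     pair_graph T \<and> connected (with_proj T) \<and>
     \<not> (\<exists>p. pre_digraph.cycle (with_proj T) p \<and> 3 \<le> length p)"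

definition connected_in :: "'a pair_pre_digraph \<Rightarrow> 'a set \<Rightarrow> bool" where
  "connected_in G A \<longleftrightarrow> A \<subseteq> pverts G \<and> connected (with_proj G \<restriction> A)"

definition tree_decomposition ::
    "'a pair_pre_digraph \<Rightarrow> 't pair_pre_digraph \<Rightarrow> ('t \<Rightarrow> 'a set) \<Rightarrow> bool" where
  "tree_decomposition G T \<beta> \<longleftrightarrow>
     undirected_tree T \<and>
     (\<forall>t\<in>pverts T. \<beta> t \<subseteq> pverts G) \<and>
     (\<forall>v\<in>pverts G. {t \<in> pverts T. v \<in> \<beta> t} \<noteq> {} \<and> connected_in T {t \<in> pverts T. v \<in> \<beta> t}) \<and>
     (\<forall>u v. (u, v) \<in> parcs G \<longrightarrow> (\<exists>t\<in>pverts T. {u, v} \<subseteq> \<beta> t))"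

text \<open>
  Widths are integers, so that the null graph has treewidth \<open>-1\<close>.
\<close>

definition td_width :: "'t pair_pre_digraph \<Rightarrow> ('t \<Rightarrow> 'a set) \<Rightarrow> int" where
  "td_width T \<beta> = int (Max ((\<lambda>t. card (\<beta> t)) ` pverts T)) - 1"

text \<open>
  A definition cannot quantify over the type of the nodes of \<open>T\<close>. Every finite tree is isomorphic to
  one whose nodes are natural numbers, so it is enough to range over the latter.
\<close>

definition treewidth :: "'a pair_pre_digraph \<Rightarrow> int" where
  "treewidth G =
     Min {td_width T \<beta> | (T :: nat pair_pre_digraph) \<beta>. tree_decomposition G T \<beta>}"

definition strict_bramble :: "'a pair_pre_digraph \<Rightarrow> 'a set set \<Rightarrow> bool" where
  "strict_bramble G \<S> \<longleftrightarrow>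
     (\<forall>A\<in>\<S>. A \<noteq> {} \<and> connected_in G A) \<and> (\<forall>A\<in>\<S>. \<forall>B\<in>\<S>. A \<inter> B \<noteq> {})"

definition hitting_set :: "'a pair_pre_digraph \<Rightarrow> 'a set set \<Rightarrow> 'a set \<Rightarrow> bool" where
  "hitting_set G \<S> S \<longleftrightarrow> S \<subseteq> pverts G \<and> (\<forall>A\<in>\<S>. S \<inter> A \<noteq> {})"

definition bramble_order :: "'a pair_pre_digraph \<Rightarrow> 'a set set \<Rightarrow> nat" where
  "bramble_order G \<S> = Min {card S | S. hitting_set G \<S> S}"

definition strict_bramble_number :: "'a pair_pre_digraph \<Rightarrow> nat" where
  "strict_bramble_number G = Max {bramble_order G \<S> | \<S>. strict_bramble G \<S>}"

definition cartesian_product ::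
    "'a pair_pre_digraph \<Rightarrow> 'b pair_pre_digraph \<Rightarrow> ('a \<times> 'b) pair_pre_digraph" (infixl "\<box>" 70) where
  "G \<box> H =
     \<lparr> pverts = pverts G \<times> pverts H,
       parcs = {((g1, h1), (g2, h2)) | g1 h1 g2 h2.
         (g1 = g2 \<and> g1 \<in> pverts G \<and> (h1, h2) \<in> parcs H) \<or>
         ((g1, g2) \<in> parcs G \<and> h1 = h2 \<and> h1 \<in> pverts H)} \<rparr>"


text \<open>The extrema above are taken over finite non-empty sets.\<close>

lemma pair_graph_cartesian_product:
  assumes "pair_graph G" and "pair_graph H"
  shows "pair_graph (G \<box> H)"
proof -
  interpret G: pair_graph G by fact
  interpret H: pair_graph H by fact
  have sub: "parcs (G \<box> H) \<subseteq> (pverts G \<times> pverts H) \<times> (pverts G \<times> pverts H)"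
    using G.in_arcsD1 G.in_arcsD2 H.in_arcsD1 H.in_arcsD2
    unfolding cartesian_product_def by fastforce
  have fin: "finite (pverts (G \<box> H))"
    by (simp add: cartesian_product_def)
  have fin_arcs: "finite (parcs (G \<box> H))"
    by (rule finite_subset[OF sub]) simp
  have symG: "(v, u) \<in> parcs G" if "(u, v) \<in> parcs G" for u v
    using G.sym_arcs that unfolding symmetric_def by (simp add: sym_def)
  have symH: "(v, u) \<in> parcs H" if "(u, v) \<in> parcs H" for u v
    using H.sym_arcs that unfolding symmetric_def by (simp add: sym_def)
  have sym: "symmetric (with_proj (G \<box> H))"
    unfolding symmetric_def with_proj_simps
    by (rule symI) (auto simp: cartesian_product_def intro: symG symH)
  have loop: "fst e \<noteq> snd e" if "e \<in> parcs (G \<box> H)" for e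
  proof -
    have "(u, u) \<notin> parcs G" for u using G.no_loops[of "(u, u)"] by auto
    moreover have "(u, u) \<notin> parcs H" for u using H.no_loops[of "(u, u)"] by auto
    ultimately show ?thesis using that by (auto simp: cartesian_product_def)
  qed
  have ends: "fst e \<in> pverts (G \<box> H)" "snd e \<in> pverts (G \<box> H)" if "e \<in> parcs (G \<box> H)" for e
    using subsetD[OF sub that] by (cases e; force simp: cartesian_product_def)+
  show ?thesis
    by unfold_locales (use fin fin_arcs sym loop ends in auto)
qed

lemma td_width_bounds:
  assumes "pair_graph G" and td: "tree_decomposition G T \<beta>"
  shows "td_width T \<beta> \<in> {-1..int (card (pverts G)) - 1}"
proof -
  interpret G: pair_graph G by fact
  from td have T: "undirected_tree T" and bags: "\<forall>t\<in>pverts T. \<beta> t \<subseteq> pverts G"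
    unfolding tree_decomposition_def by blast+
  from T interpret T: pair_graph T
    unfolding undirected_tree_def by blast
  have fin: "finite (pverts T)"
    by (rule T.pair_finite_verts)
  have ne: "pverts T \<noteq> {}"
    using T by (simp add: undirected_tree_def connected_def strongly_connected_def mk_symmetric_def)
  have "card (\<beta> t) \<le> card (pverts G)" if "t \<in> pverts T" for t
    using bags that G.pair_finite_verts by (intro card_mono) blast+
  then have "Max ((\<lambda>t. card (\<beta> t)) ` pverts T) \<le> card (pverts G)"
    using fin ne by simp
  then show ?thesis by (simp add: td_width_def)
qed

lemma finite_td_widths:
  assumes "pair_graph G"
  shows "finite {td_width T \<beta> | (T :: 't pair_pre_digraph) \<beta>. tree_decomposition G T \<beta>}"
proof (rule finite_subset)
  show "{td_width T \<beta> | (T :: 't pair_pre_digraph) \<beta>. tree_decomposition G T \<beta>}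
      \<subseteq> {-1..int (card (pverts G)) - 1}"
    by (rule subsetI, elim CollectE exE conjE, hypsubst, rule td_width_bounds[OF assms])
qed simp

lemma tree_decomposition_single_bag:
  assumes "pair_graph G"
  shows "tree_decomposition G \<lparr> pverts = {t}, parcs = {} \<rparr> (\<lambda>_. pverts G)"
proof -
  interpret G: pair_graph G by fact
  define T where "T = \<lparr> pverts = {t}, parcs = {} :: ('b \<times> 'b) set \<rparr>"
  have T_simps: "pverts T = {t}" "parcs T = {}"
    by (simp_all add: T_def)
  have "symmetric (with_proj T)"
    by (simp add: symmetric_def T_simps sym_def)
  then have pg: "pair_graph T"
    by unfold_locales (simp_all add: T_simps)
  have refl: "(t, t) \<in> rtrancl_on {t} r" for r
    by (rule rtrancl_on_refl) simp
  have conn: "connected (with_proj T)"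
    by (simp add: connected_def strongly_connected_def mk_symmetric_def reachable_def T_simps refl)
  have conn': "connected (with_proj T \<restriction> {t})"
    by (simp add: connected_def strongly_connected_def mk_symmetric_def reachable_def refl)
  have "p = []" if "pre_digraph.awalk (with_proj T) u p v" for u p v
    using that by (simp add: pre_digraph.awalk_def T_simps)
  then have "\<not> pre_digraph.cycle (with_proj T) p" for p
    by (auto simp: pre_digraph.cycle_def)
  then have "undirected_tree T"
    using conn pg unfolding undirected_tree_def by blast
  then have "tree_decomposition G T (\<lambda>_. pverts G)"
    using conn' G.in_arcsD1 G.in_arcsD2
    by (simp add: tree_decomposition_def connected_in_def T_simps)
  then show ?thesis by (simp add: T_def)
qed

lemma td_widths_nonempty:
  assumes "pair_graph G"
  shows "{td_width T \<beta> | (T :: 't pair_pre_digraph) \<beta>. tree_decomposition G T \<beta>} \<noteq> {}"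
proof -
  let ?T = "\<lparr> pverts = {undefined :: 't}, parcs = {} \<rparr>" and ?\<beta> = "\<lambda>_ :: 't. pverts G"
  have "td_width ?T ?\<beta> \<in> {td_width T \<beta> | (T :: 't pair_pre_digraph) \<beta>. tree_decomposition G T \<beta>}"
    by (rule CollectI, rule exI[of _ ?T], rule exI[of _ ?\<beta>])
      (rule conjI[OF refl tree_decomposition_single_bag[OF assms]])
  then show ?thesis by (rule ex_in_conv[THEN iffD1, OF exI])
qed

lemma hitting_set_pverts:
  assumes "strict_bramble G \<S>"
  shows "hitting_set G \<S> (pverts G)"
  using assms by (fastforce simp: strict_bramble_def hitting_set_def connected_in_def)

lemma finite_hitting_sets:
  assumes "pair_graph G"
  shows "finite {card S | S. hitting_set G \<S> S}"
proof -
  interpret G: pair_graph G by fact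
  have "{card S | S. hitting_set G \<S> S} \<subseteq> card ` Pow (pverts G)"
    by (auto simp: hitting_set_def)
  then show ?thesis by (rule finite_subset) simp
qed

lemma finite_strict_bramble_orders:
  assumes "pair_graph G"
  shows "finite {bramble_order G \<S> | \<S>. strict_bramble G \<S>}"
proof -
  interpret G: pair_graph G by fact
  have "{bramble_order G \<S> | \<S>. strict_bramble G \<S>} \<subseteq> bramble_order G ` Pow (Pow (pverts G))"
    by (auto simp: strict_bramble_def connected_in_def)
  then show ?thesis by (rule finite_subset) simp
qed

lemma strict_bramble_empty: "strict_bramble G {}"
  by (simp add: strict_bramble_def)

end

theory Submission
  imports Defs
begin

text \<open>
  Take a strict bramble \<open>\<S>\<close> of \<open>G\<close> and a tree-decomposition \<open>(T, \<beta>)\<close> of \<open>G \<box> H\<close>. For \<open>A \<in> \<S>\<close> and a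
  vertex \<open>h\<close> of \<open>H\<close>, the nodes whose bags meet \<open>A \<times> {h}\<close> form a subtree of \<open>T\<close>. Two such subtrees
  with equal or adjacent second coordinates \<open>h, h'\<close> intersect, since \<open>A\<close> and \<open>B\<close> share a vertex \<open>g\<close> and
  \<open>(g, h)\<close>, \<open>(g, h')\<close> lie in a common bag. By the Helly property of subtrees, the nodes whose bags
  meet \<open>A \<times> {h}\<close> for all \<open>A \<in> \<S>\<close> form a subtree for every \<open>h\<close>, and these subtrees intersect for
  adjacent \<open>h, h'\<close>. They therefore define a tree-decomposition of \<open>H\<close> over \<open>T\<close>; if \<open>h\<close> is in its bag at
  \<open>t\<close>, then \<open>\<beta> t\<close> contains a hitting set of \<open>\<S>\<close> in the copy of \<open>G\<close> at \<open>h\<close>, so \<open>\<beta> t\<close> is at least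
  the order of \<open>\<S>\<close> times as large as that bag.
\<close>

section \<open>Connected sets\<close>

lemma sym_parcs:
  assumes "pair_graph G"
  shows "sym (parcs G)"
proof -
  interpret pair_graph G by fact
  show ?thesis
    using sym_arcs by (simp add: symmetric_def)
qed

text \<open>The arcs of a \<open>pair_graph\<close> are symmetric already, so symmetrising the
  restriction adds nothing. Plain \<open>rtrancl\<close> can then replace \<open>rtrancl_on\<close>,
  as both endpoints lie in \<open>A\<close>.\<close>

lemma connected_in_iff:
  assumes "pair_graph G"
  shows "connected_in G A \<longleftrightarrow>
    A \<subseteq> pverts G \<and> A \<noteq> {} \<and> (\<forall>x\<in>A. \<forall>y\<in>A. (x, y) \<in> (parcs G \<inter> A \<times> A)\<^sup>*)"
proof -
  have parcs: "parcs (mk_symmetric (with_proj G \<restriction> A)) = parcs G \<inter> A \<times> A"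
    using symD[OF sym_parcs[OF assms]] by (auto simp: parcs_mk_symmetric)
  have "(x, y) \<in> rtrancl_on A (parcs G \<inter> A \<times> A) \<longleftrightarrow> (x, y) \<in> (parcs G \<inter> A \<times> A)\<^sup>*"
    if "x \<in> A" "y \<in> A" for x y
    by (rule iffI, erule rtrancl_on_rtranclI, erule rtrancl_consistent_rtrancl_on) (use that in auto)
  then show ?thesis
    unfolding connected_in_def connected_def strongly_connected_def reachable_def
    by (auto simp: parcs)
qed

lemma connected_in_Un:
  assumes G: "pair_graph G" and A: "connected_in G A" and B: "connected_in G B" and "A \<inter> B \<noteq> {}"
  shows "connected_in G (A \<union> B)"
proof -
  let ?R = "(parcs G \<inter> (A \<union> B) \<times> (A \<union> B))\<^sup>*"
  obtain z where z: "z \<in> A" "z \<in> B"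
    using \<open>A \<inter> B \<noteq> {}\<close> by blast
  have "(parcs G \<inter> A \<times> A)\<^sup>* \<subseteq> ?R" "(parcs G \<inter> B \<times> B)\<^sup>* \<subseteq> ?R"
    by (intro rtrancl_mono; blast)+
  then have "(x, z) \<in> ?R" "(z, x) \<in> ?R" if "x \<in> A \<union> B" for x
    using A B that z unfolding connected_in_iff[OF G] by blast+
  then show ?thesis
    using A B unfolding connected_in_iff[OF G] by (blast intro: rtrancl_trans)
qed

lemma rtrancl_last_exit:
  assumes "(x, y) \<in> r\<^sup>*" "x \<in> K" "y \<notin> K"
  obtains a b where "(a, b) \<in> r" "a \<in> K" "b \<notin> K" "(b, y) \<in> (r \<inter> (- K) \<times> (- K))\<^sup>*"
proof -
  \<comment> \<open>The induction moves the start of the walk, so the claim must also cover starts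
    from which the walk never enters \<open>K\<close>.\<close>
  have "(x \<notin> K \<and> (x, y) \<in> (r \<inter> (- K) \<times> (- K))\<^sup>*) \<or>
    (\<exists>a b. (a, b) \<in> r \<and> a \<in> K \<and> b \<notin> K \<and> (b, y) \<in> (r \<inter> (- K) \<times> (- K))\<^sup>*)"
    using assms(1)
  proof (induction rule: converse_rtrancl_induct)
    case base
    then show ?case using assms(3) by blast
  next
    case (step x z)
    then show ?case
      by (cases "x \<in> K") (blast intro: converse_rtrancl_into_rtrancl)+
  qed
  then show ?thesis using assms(2) that by blast
qed

section \<open>Subtrees and the Helly property\<close>

text \<open>A path from \<open>b\<close> to \<open>a\<close> that avoids the edge would close up
  with \<open>(a, b)\<close> to a cycle. Acyclicity of \<open>T\<close> enters the later arguments
  only through this fact.\<close>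

lemma undirected_tree_bridge:
  assumes T: "undirected_tree T" and ab: "(a, b) \<in> parcs T"
  shows "(b, a) \<notin> (parcs T - {(a, b), (b, a)})\<^sup>*"
proof
  assume ba: "(b, a) \<in> (parcs T - {(a, b), (b, a)})\<^sup>*"
  interpret T: pair_graph T
    using T by (simp add: undirected_tree_def)
  define D where "D = \<lparr> pverts = pverts T, parcs = parcs T - {(a, b), (b, a)} \<rparr>"
  interpret D: pair_wf_digraph D
    by unfold_locales (auto simp: D_def T.in_arcsD1 T.in_arcsD2)
  have "a \<noteq> b"
    using T.no_loops[OF ab] by simp
  have verts: "a \<in> pverts T" "b \<in> pverts T"
    using ab T.in_arcsD1 T.in_arcsD2 by blast+
  have "b \<rightarrow>\<^sup>*\<^bsub>with_proj D\<^esub> a"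
    using ba verts unfolding D.reachable_conv by (simp add: D_def)
  then obtain p where p: "D.apath b p a"
    unfolding D.reachable_apath by blast
  have "subgraph (with_proj D) (with_proj T)"
    by (rule subgraphI)
      (auto simp: D_def compatible_def T.wf_digraph intro: D.wf_digraph[unfolded D_def])
  then have Tp: "T.apath b p a"
    using p by (rule T.subgraph_apath_imp_apath[rotated])
  then have walk: "T.awalk b (p @ [(a, b)]) b"
    using ab verts by (intro T.awalk_appendI[of b p a]) (auto simp: T.apath_def T.awalk_simps)
  have "distinct (tl (T.awalk_verts b (p @ [(a, b)])))"
  proof -
    have "T.awalk_verts b (p @ [(a, b)]) = T.awalk_verts b p @ [b]"
      using walk T.awalk_verts_append[OF walk] by simp
    moreover have "distinct (T.awalk_verts b p)"
      using Tp by (simp add: T.apath_def)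
    moreover obtain vs where "T.awalk_verts b p = b # vs"
      using Tp by (cases p) (auto simp: T.apath_def T.awalk_simps)
    ultimately show ?thesis by simp
  qed
  then have "T.cycle (p @ [(a, b)])"
    using walk unfolding T.cycle_def by blast
  \<comment> \<open>Since \<open>D\<close> lacks \<open>(b, a)\<close>, the path is not that single
    arc. The closed walk thus has length at least 3 and is not a mere back-and-forth.\<close>
  moreover have "2 \<le> length p"
  proof -
    have "p \<noteq> []"
      using Tp \<open>a \<noteq> b\<close> by (auto simp: T.apath_def T.awalk_simps)
    moreover have "p \<noteq> [e]" for e
    proof
      assume "p = [e]"
      then have "e = (b, a)" "e \<in> parcs D"
        using p by (auto simp: D.apath_def D.awalk_simps)
      then show False by (simp add: D_def)
    qed
    ultimately show ?thesis
      \<comment> \<open>The rule just splits lists into empty, singleton and longer ones.\<close>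
      by (cases p rule: remdups_adj.cases) auto
  qed
  ultimately show False
    using T unfolding undirected_tree_def by fastforce
qed

text \<open>Suppose \<open>y\<close> is outside the component \<open>K\<close> of \<open>x\<close>
  in \<open>A \<inter> B\<close>. A walk in \<open>A\<close> from \<open>x\<close> to
  \<open>y\<close> leaves \<open>K\<close> for the last time by an arc \<open>(a, b)\<close>. Its
  rest avoids \<open>a\<close>, and a walk in \<open>B\<close> from \<open>y\<close> back to
  \<open>a\<close> avoids \<open>b\<close>, so together they bypass the edge, which is a
  bridge.\<close>

lemma connected_in_Int:
  assumes T: "undirected_tree T" and A: "connected_in T A" and B: "connected_in T B"
    and ne: "A \<inter> B \<noteq> {}"
  shows "connected_in T (A \<inter> B)"
proof -
  have pg: "pair_graph T"
    using T by (simp add: undirected_tree_def)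
  note conn = connected_in_iff[OF pg]
  let ?R = "\<lambda>X. parcs T \<inter> X \<times> X"
  have "(x, y) \<in> (?R (A \<inter> B))\<^sup>*" if x: "x \<in> A \<inter> B" and y: "y \<in> A \<inter> B" for x y
  proof (rule ccontr)
    assume nxy: "(x, y) \<notin> (?R (A \<inter> B))\<^sup>*"
    define K where "K = {u. (x, u) \<in> (?R (A \<inter> B))\<^sup>*}"
    have "(x, y) \<in> (?R A)\<^sup>*"
      using A x y unfolding conn by blast
    moreover have "x \<in> K" "y \<notin> K"
      using nxy by (auto simp: K_def)
    ultimately obtain a b where ab: "(a, b) \<in> ?R A" and a: "a \<in> K" and b: "b \<notin> K"
      and by': "(b, y) \<in> (?R A \<inter> (- K) \<times> (- K))\<^sup>*"
      by (rule rtrancl_last_exit)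
    have "a \<in> A \<inter> B"
      using a x by (auto simp: K_def elim: rtranclE)
    have "b \<notin> B"
    proof
      assume "b \<in> B"
      then have "(a, b) \<in> ?R (A \<inter> B)"
        using ab \<open>a \<in> A \<inter> B\<close> by blast
      then show False
        using a b unfolding K_def by (auto intro: rtrancl_into_rtrancl)
    qed
    have "(y, a) \<in> (?R B)\<^sup>*"
      using B y \<open>a \<in> A \<inter> B\<close> unfolding conn by blast
    moreover have "(?R B)\<^sup>* \<subseteq> (parcs T - {(a, b), (b, a)})\<^sup>*"
      using \<open>b \<notin> B\<close> by (intro rtrancl_mono) blast
    moreover have "(?R A \<inter> (- K) \<times> (- K))\<^sup>* \<subseteq> (parcs T - {(a, b), (b, a)})\<^sup>*"
      using a by (intro rtrancl_mono) blast
    ultimately have "(b, a) \<in> (parcs T - {(a, b), (b, a)})\<^sup>*"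
      using by' by (blast intro: rtrancl_trans)
    then show False
      using undirected_tree_bridge[OF T] ab by blast
  qed
  then show ?thesis
    using A ne unfolding conn by blast
qed

text \<open>If the triple intersection is empty, a walk from \<open>x\<close> to \<open>y\<close>
  inside \<open>B \<inter> (A \<union> C)\<close> has an arc \<open>(a, b)\<close> from
  \<open>A - C\<close> to \<open>C - A\<close>. Going from \<open>b\<close> through \<open>C\<close>
  to \<open>z\<close> and through \<open>A\<close> to \<open>a\<close> bypasses this bridge.\<close>

lemma connected_in_Int3_nonempty:
  assumes T: "undirected_tree T"
    and A: "connected_in T A" and B: "connected_in T B" and C: "connected_in T C"
    and AB: "A \<inter> B \<noteq> {}" and BC: "B \<inter> C \<noteq> {}" and CA: "C \<inter> A \<noteq> {}"
  shows "A \<inter> B \<inter> C \<noteq> {}"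
proof
  assume empty: "A \<inter> B \<inter> C = {}"
  have pg: "pair_graph T"
    using T by (simp add: undirected_tree_def)
  note conn = connected_in_iff[OF pg]
  let ?R = "\<lambda>X. parcs T \<inter> X \<times> X"
  obtain x y z where x: "x \<in> A \<inter> B" and y: "y \<in> B \<inter> C" and z: "z \<in> C \<inter> A"
    using AB BC CA by blast
  have "connected_in T (A \<union> C)"
    using connected_in_Un[OF pg A C] CA by blast
  then have "connected_in T (B \<inter> (A \<union> C))"
    using connected_in_Int[OF T B] x by blast
  then have "(x, y) \<in> (?R (B \<inter> (A \<union> C)))\<^sup>*"
    using x y unfolding conn by blast
  moreover have "x \<in> A" "y \<notin> A"
    using x y empty by blast+
  ultimately obtain a b where ab: "(a, b) \<in> ?R (B \<inter> (A \<union> C))" and "a \<in> A" "b \<notin> A"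
    by (rule rtrancl_last_exit)
  then have "a \<notin> C" "b \<in> C"
    using empty by blast+
  have "(b, z) \<in> (?R C)\<^sup>*" "(z, a) \<in> (?R A)\<^sup>*"
    using A C z \<open>a \<in> A\<close> \<open>b \<in> C\<close> unfolding conn by blast+
  moreover have "(?R C)\<^sup>* \<subseteq> (parcs T - {(a, b), (b, a)})\<^sup>*"
    using \<open>a \<notin> C\<close> by (intro rtrancl_mono) blast
  moreover have "(?R A)\<^sup>* \<subseteq> (parcs T - {(a, b), (b, a)})\<^sup>*"
    using \<open>b \<notin> A\<close> by (intro rtrancl_mono) blast
  ultimately have "(b, a) \<in> (parcs T - {(a, b), (b, a)})\<^sup>*"
    by (blast intro: rtrancl_trans)
  then show False
    using undirected_tree_bridge[OF T] ab by blast
qed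

text \<open>Both claims need a joint induction: the second one, applied to the new member
  \<open>A\<close>, shows that \<open>A\<close> meets the intersection so far, which the first one
  and the three-set lemma require.\<close>

lemma undirected_tree_Helly:
  assumes T: "undirected_tree T" and "finite \<F>" "\<F> \<noteq> {}"
    and "\<And>A. A \<in> \<F> \<Longrightarrow> connected_in T A"
    and "\<And>A B. A \<in> \<F> \<Longrightarrow> B \<in> \<F> \<Longrightarrow> A \<inter> B \<noteq> {}"
  shows "connected_in T (\<Inter>\<F>)"
    and "connected_in T C \<Longrightarrow> (\<And>A. A \<in> \<F> \<Longrightarrow> C \<inter> A \<noteq> {}) \<Longrightarrow> C \<inter> \<Inter>\<F> \<noteq> {}"
proof -
  have "connected_in T (\<Inter>\<F>) \<and>
    (\<forall>C. connected_in T C \<longrightarrow> (\<forall>A\<in>\<F>. C \<inter> A \<noteq> {}) \<longrightarrow> C \<inter> \<Inter>\<F> \<noteq> {})"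
    using assms(2-)
  proof (induction rule: finite_ne_induct)
    case (singleton A)
    then show ?case by simp
  next
    case (insert A \<F>)
    have A: "connected_in T A"
      using insert.prems by blast
    have IH: "connected_in T (\<Inter>\<F>)"
      "\<And>C. connected_in T C \<Longrightarrow> \<forall>B\<in>\<F>. C \<inter> B \<noteq> {} \<Longrightarrow> C \<inter> \<Inter>\<F> \<noteq> {}"
      using insert by (simp_all add: insert.IH)
    have meet: "A \<inter> \<Inter>\<F> \<noteq> {}"
      using IH(2)[OF A] insert.prems(2) by blast
    have "C \<inter> (A \<inter> \<Inter>\<F>) \<noteq> {}" if C: "connected_in T C" "\<forall>B\<in>insert A \<F>. C \<inter> B \<noteq> {}" for C
    proof -
      have "C \<inter> \<Inter>\<F> \<noteq> {}" "C \<inter> A \<noteq> {}"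
        using C IH(2) by simp_all
      then have "C \<inter> A \<inter> \<Inter>\<F> \<noteq> {}"
        using meet by (intro connected_in_Int3_nonempty[OF T C(1) A IH(1)]) (auto simp: Int_commute)
      then show ?thesis by (simp add: Int_assoc)
    qed
    then show ?case
      using connected_in_Int[OF T A IH(1) meet] by simp
  qed
  then show "connected_in T (\<Inter>\<F>)"
    and "connected_in T C \<Longrightarrow> (\<And>A. A \<in> \<F> \<Longrightarrow> C \<inter> A \<noteq> {}) \<Longrightarrow> C \<inter> \<Inter>\<F> \<noteq> {}"
    by blast+
qed

section \<open>Tree-decompositions of Cartesian products\<close>

text \<open>Along a walk in \<open>A\<close>, consecutive vertices share a bag, so the subtrees of
  the single vertices overlap and merge into one.\<close>

lemma tree_decomposition_connected_in:
  assumes G: "pair_graph G" and td: "tree_decomposition G T \<beta>" and A: "connected_in G A"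
  shows "connected_in T {t \<in> pverts T. \<beta> t \<inter> A \<noteq> {}}" (is "connected_in T ?U")
proof -
  have pg: "pair_graph T"
    using td by (simp add: tree_decomposition_def undirected_tree_def)
  let ?R = "\<lambda>X. (parcs T \<inter> X \<times> X)\<^sup>*"
  have AG: "A \<subseteq> pverts G"
    using A by (simp add: connected_in_def)
  have edge: "\<exists>r\<in>pverts T. {u, v} \<subseteq> \<beta> r" if "(u, v) \<in> parcs G" for u v
    using td that by (simp add: tree_decomposition_def)
  have trace: "(s, t) \<in> ?R ?U"
    if "v \<in> A" "s \<in> pverts T" "t \<in> pverts T" "v \<in> \<beta> s" "v \<in> \<beta> t" for v s t
  proof -
    let ?V = "{t \<in> pverts T. v \<in> \<beta> t}"
    have "connected_in T ?V"
      using td AG \<open>v \<in> A\<close> unfolding tree_decomposition_def by blast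
    then have "(s, t) \<in> ?R ?V"
      using that unfolding connected_in_iff[OF pg] by blast
    moreover have "?R ?V \<subseteq> ?R ?U"
      using \<open>v \<in> A\<close> by (intro rtrancl_mono) blast
    ultimately show ?thesis by blast
  qed
  have reach: "(s, t) \<in> ?R ?U"
    if "(x, y) \<in> (parcs G \<inter> A \<times> A)\<^sup>*" "x \<in> A" "s \<in> pverts T" "x \<in> \<beta> s" "t \<in> pverts T" "y \<in> \<beta> t"
    for x y s t
    using that(1,5,6)
  proof (induction arbitrary: t)
    case base
    show ?case
      by (rule trace[OF that(2,3) base(1) that(4) base(2)])
  next
    case (step y z)
    have "(y, z) \<in> parcs G"
      using step.hyps(2) by simp_all
    then obtain r where r: "r \<in> pverts T" "y \<in> \<beta> r" "z \<in> \<beta> r"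
      using edge by blast
    have "(s, r) \<in> ?R ?U"
      by (rule step.IH[OF r(1,2)])
    also have "(r, t) \<in> ?R ?U"
      by (rule trace[OF _ r(1) step.prems(1) r(3) step.prems(2)]) (use step.hyps(2) in simp)
    finally show ?case .
  qed
  have "(s, t) \<in> ?R ?U" if s: "s \<in> ?U" and t: "t \<in> ?U" for s t
  proof -
    obtain x y where xy: "x \<in> \<beta> s \<inter> A" "y \<in> \<beta> t \<inter> A"
      using s t by blast
    then have "(x, y) \<in> (parcs G \<inter> A \<times> A)\<^sup>*"
      using A unfolding connected_in_iff[OF G] by blast
    then show ?thesis
      using xy s t by (intro reach[of x y]) auto
  qed
  moreover have "?U \<noteq> {}"
  proof -
    obtain v where "v \<in> A"
      using A unfolding connected_in_iff[OF G] by blast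
    then show ?thesis
      using AG td unfolding tree_decomposition_def by blast
  qed
  ultimately show ?thesis
    unfolding connected_in_iff[OF pg] by blast
qed

lemma connected_in_cartesian_product:
  assumes G: "pair_graph G" and H: "pair_graph H" and A: "connected_in G A" and h: "h \<in> pverts H"
  shows "connected_in (G \<box> H) (A \<times> {h})"
proof -
  let ?R = "(parcs (G \<box> H) \<inter> (A \<times> {h}) \<times> (A \<times> {h}))\<^sup>*"
  have "((x, h), (y, h)) \<in> ?R" if "(x, y) \<in> (parcs G \<inter> A \<times> A)\<^sup>*" for x y
    using that
  proof induction
    case (step y z)
    then have "((y, h), (z, h)) \<in> parcs (G \<box> H) \<inter> (A \<times> {h}) \<times> (A \<times> {h})"
      using h by (auto simp: cartesian_product_def)
    with step.IH show ?case by (rule rtrancl_into_rtrancl)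
  qed simp
  moreover have "A \<times> {h} \<subseteq> pverts (G \<box> H)"
    using A h by (auto simp: connected_in_def cartesian_product_def)
  ultimately show ?thesis
    using A unfolding connected_in_iff[OF G] connected_in_iff[OF pair_graph_cartesian_product[OF G H]]
    by blast
qed

lemma tree_decomposition_strict_bramble:
  assumes G: "pair_graph G" and H: "pair_graph H" and td: "tree_decomposition (G \<box> H) T \<beta>"
    and \<S>: "strict_bramble G \<S>" and "\<S> \<noteq> {}"
  shows "tree_decomposition H T (\<lambda>t. {h \<in> pverts H. \<forall>A\<in>\<S>. \<beta> t \<inter> A \<times> {h} \<noteq> {}})"
proof -
  interpret H: pair_graph H by fact
  interpret G: pair_graph G by fact
  have T: "undirected_tree T"
    using td by (simp add: tree_decomposition_def)
  \<comment> \<open>\<open>U A h\<close> is the subtree traced by the copy of \<open>A\<close> at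
    \<open>h\<close>; \<open>X h\<close> will be the set of nodes whose new bag contains
    \<open>h\<close>.\<close>
  define U where "U A h = {t \<in> pverts T. \<beta> t \<inter> A \<times> {h} \<noteq> {}}" for A h
  define X where "X h = \<Inter>((\<lambda>A. U A h) ` \<S>)" for h
  have fin: "finite \<S>"
    by (rule finite_subset[of _ "Pow (pverts G)"])
      (use \<S> in \<open>auto simp: strict_bramble_def connected_in_def\<close>)
  have conn: "connected_in T (U A h)" if "A \<in> \<S>" "h \<in> pverts H" for A h
    unfolding U_def using \<S> that
    by (intro tree_decomposition_connected_in[OF pair_graph_cartesian_product[OF G H] td]
        connected_in_cartesian_product[OF G H]) (simp_all add: strict_bramble_def)
  \<comment> \<open>The case \<open>h = k\<close> gives the pairwise intersections within one
    family, the case of an arc those between the families of neighbours.\<close>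
  have meet: "U A h \<inter> U B k \<noteq> {}"
    if AB: "A \<in> \<S>" "B \<in> \<S>" and hk: "h \<in> pverts H" "h = k \<or> (h, k) \<in> parcs H" for A B h k
  proof -
    obtain g where g: "g \<in> A" "g \<in> B"
      using \<S> AB unfolding strict_bramble_def by blast
    then have gG: "g \<in> pverts G"
      using \<S> AB unfolding strict_bramble_def connected_in_def by blast
    have "\<exists>t\<in>pverts T. {(g, h), (g, k)} \<subseteq> \<beta> t"
    proof (cases "h = k")
      case True
      have "(g, h) \<in> pverts (G \<box> H)"
        using gG hk by (simp add: cartesian_product_def)
      then have "{t \<in> pverts T. (g, h) \<in> \<beta> t} \<noteq> {}"
        using td unfolding tree_decomposition_def by blast
      then show ?thesis using True by blast
    next
      case False
      then have "((g, h), (g, k)) \<in> parcs (G \<box> H)"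
        using gG hk by (simp add: cartesian_product_def)
      then show ?thesis
        using td unfolding tree_decomposition_def by blast
    qed
    then show ?thesis
      using g unfolding U_def by blast
  qed
  have X_conn: "connected_in T (X h)" if "h \<in> pverts H" for h
    unfolding X_def
    by (rule undirected_tree_Helly(1)[OF T]) (use that fin \<open>\<S> \<noteq> {}\<close> conn meet in auto)
  have X_meet: "X h \<inter> X k \<noteq> {}" if "(h, k) \<in> parcs H" for h k
  proof -
    have hk: "h \<in> pverts H" "k \<in> pverts H"
      using that H.in_arcsD1 H.in_arcsD2 by blast+
    \<comment> \<open>Helly is used twice: each \<open>U B k\<close> meets every member of the
      family at \<open>h\<close>, hence \<open>X h\<close>; then \<open>X h\<close> meets every
      member of the family at \<open>k\<close>, hence \<open>X k\<close>.\<close>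
    have "U B k \<inter> X h \<noteq> {}" if B: "B \<in> \<S>" for B
      unfolding X_def
      by (rule undirected_tree_Helly(2)[OF T])
        (use fin \<open>\<S> \<noteq> {}\<close> conn meet \<open>(h, k) \<in> parcs H\<close> hk B in \<open>auto simp: Int_commute\<close>)
    then show ?thesis
      unfolding X_def[of k]
      by (intro undirected_tree_Helly(2)[OF T])
        (use fin \<open>\<S> \<noteq> {}\<close> conn meet X_conn hk in \<open>auto simp: Int_commute\<close>)
  qed
  define \<gamma> where "\<gamma> t = {h \<in> pverts H. \<forall>A\<in>\<S>. \<beta> t \<inter> A \<times> {h} \<noteq> {}}" for t
  \<comment> \<open>A member of \<open>\<S>\<close> confines \<open>X h\<close> to
    \<open>pverts T\<close>; the intersection of the empty family would be
    \<open>UNIV\<close>.\<close>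
  have X_eq: "X h = {t \<in> pverts T. h \<in> \<gamma> t}" if "h \<in> pverts H" for h
    using that \<open>\<S> \<noteq> {}\<close> by (auto simp: X_def U_def \<gamma>_def)
  have "{t \<in> pverts T. h \<in> \<gamma> t} \<noteq> {} \<and> connected_in T {t \<in> pverts T. h \<in> \<gamma> t}"
    if "h \<in> pverts H" for h
    using X_conn[OF that] T connected_in_iff[of T "X h"] unfolding X_eq[OF that] undirected_tree_def
    by simp
  moreover have "\<exists>t\<in>pverts T. {h, k} \<subseteq> \<gamma> t" if "(h, k) \<in> parcs H" for h k
  proof -
    have "h \<in> pverts H" "k \<in> pverts H"
      using that H.in_arcsD1 H.in_arcsD2 by blast+
    then show ?thesis
      using X_meet[OF that] by (auto simp: X_eq)
  qed
  moreover have "\<gamma> t \<subseteq> pverts H" for t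
    by (auto simp: \<gamma>_def)
  ultimately show ?thesis
    unfolding tree_decomposition_def \<gamma>_def[symmetric] using T by simp
qed

section \<open>Bag sizes and attained extrema\<close>

lemma bramble_order_le_card:
  assumes "pair_graph G" "hitting_set G \<S> S"
  shows "bramble_order G \<S> \<le> card S"
  unfolding bramble_order_def
  using assms by (intro Min_le finite_hitting_sets) auto

text \<open>For every \<open>h\<close> counted, the slice of \<open>b\<close> at \<open>h\<close>
  projects to a hitting set of \<open>\<S>\<close>, and slices at different \<open>h\<close> are
  disjoint.\<close>

lemma card_bag_ge_bramble_order:
  assumes G: "pair_graph G" and H: "pair_graph H" and b: "b \<subseteq> pverts (G \<box> H)"
  shows "bramble_order G \<S> * card {h \<in> pverts H. \<forall>A\<in>\<S>. b \<inter> A \<times> {h} \<noteq> {}} \<le> card b"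
    (is "_ * card ?K \<le> _")
proof -
  interpret G: pair_graph G by fact
  interpret H: pair_graph H by fact
  let ?S = "\<lambda>h. {g. (g, h) \<in> b}"
  have sub: "?S h \<subseteq> pverts G" for h
    using b by (auto simp: cartesian_product_def)
  have fin: "finite b"
    using b by (rule finite_subset) (simp add: cartesian_product_def)
  have "bramble_order G \<S> * card ?K = (\<Sum>h\<in>?K. bramble_order G \<S>)"
    by simp
  also have "\<dots> \<le> (\<Sum>h\<in>?K. card (?S h))"
  proof (rule sum_mono)
    fix h assume "h \<in> ?K"
    then have "hitting_set G \<S> (?S h)"
      using sub by (fastforce simp: hitting_set_def)
    then show "bramble_order G \<S> \<le> card (?S h)"
      by (rule bramble_order_le_card[OF G])
  qed
  also have "\<dots> = card (SIGMA h:?K. ?S h)"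
    using finite_subset[OF sub] by (intro card_SigmaI[symmetric]) auto
  \<comment> \<open>The sigma set has \<open>h\<close> first, the vertices of the product have it
    second.\<close>
  also have "\<dots> = card (prod.swap ` (SIGMA h:?K. ?S h))"
    by (intro card_image[symmetric]) simp
  also have "\<dots> \<le> card b"
    by (intro card_mono fin) auto
  finally show ?thesis .
qed

lemma treewidth_le:
  assumes "pair_graph G" "tree_decomposition G (T :: nat pair_pre_digraph) \<beta>"
  shows "treewidth G \<le> td_width T \<beta>"
  unfolding treewidth_def using assms by (intro Min_le finite_td_widths) auto

lemma treewidth_attained:
  assumes "pair_graph G"
  obtains T :: "nat pair_pre_digraph" and \<beta> where "tree_decomposition G T \<beta>" "treewidth G = td_width T \<beta>"
proof -
  have "treewidth G \<in> {td_width T \<beta> | (T :: nat pair_pre_digraph) \<beta>. tree_decomposition G T \<beta>}"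
    unfolding treewidth_def by (rule Min_in[OF finite_td_widths[OF assms] td_widths_nonempty[OF assms]])
  then show ?thesis using that by blast
qed

lemma strict_bramble_number_attained:
  assumes "pair_graph G"
  obtains \<S> where "strict_bramble G \<S>" "strict_bramble_number G = bramble_order G \<S>"
proof -
  have "{bramble_order G \<S> | \<S>. strict_bramble G \<S>} \<noteq> {}"
    using strict_bramble_empty by blast
  then have "strict_bramble_number G \<in> {bramble_order G \<S> | \<S>. strict_bramble G \<S>}"
    unfolding strict_bramble_number_def by (rule Max_in[OF finite_strict_bramble_orders[OF assms]])
  then show ?thesis using that by blast
qed

theorem theorem7:
  fixes G :: "'a pair_pre_digraph" and H :: "'b pair_pre_digraph"
  assumes "pair_graph G" and "pair_graph H"
  shows "treewidth (G \<box> H) \<ge> int (strict_bramble_number G) * (treewidth H + 1) - 1"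
proof -
  note GH = pair_graph_cartesian_product[OF assms]
  obtain T :: "nat pair_pre_digraph" and \<beta>
    where td: "tree_decomposition (G \<box> H) T \<beta>" and tw: "treewidth (G \<box> H) = td_width T \<beta>"
    using treewidth_attained[OF GH] .
  obtain \<S> where \<S>: "strict_bramble G \<S>" and s: "strict_bramble_number G = bramble_order G \<S>"
    using strict_bramble_number_attained[OF assms(1)] .
  show ?thesis
  proof (cases "\<S> = {}")
    \<comment> \<open>The empty set hits the empty bramble, so its order is 0 and only treewidth at
      least -1 is left to show.\<close>
    case True
    then have "bramble_order G \<S> \<le> card ({} :: 'a set)"
      by (intro bramble_order_le_card[OF assms(1)]) (simp add: hitting_set_def)
    then show ?thesis
      using td_width_bounds[OF GH td] by (simp add: tw s)
  next
    case False
    define \<gamma> where "\<gamma> t = {h \<in> pverts H. \<forall>A\<in>\<S>. \<beta> t \<inter> A \<times> {h} \<noteq> {}}" for t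
    have td': "tree_decomposition H T \<gamma>"
      unfolding \<gamma>_def by (rule tree_decomposition_strict_bramble[OF assms td \<S> False])
    have pg: "pair_graph T" and conn: "connected (with_proj T)"
      using td by (simp_all add: tree_decomposition_def undirected_tree_def)
    interpret T: pair_graph T by (rule pg)
    have fin: "finite (pverts T)" and ne: "pverts T \<noteq> {}"
      using conn by (simp_all add: connected_def strongly_connected_def)
    \<comment> \<open>A node \<open>t\<close> with a largest bag of \<open>\<gamma>\<close>
      suffices: that bag has at least \<open>treewidth H + 1\<close> vertices, and
      \<open>\<beta> t\<close> is at least the bramble order times as large.\<close>
    have "Max ((\<lambda>t. card (\<gamma> t)) ` pverts T) \<in> (\<lambda>t. card (\<gamma> t)) ` pverts T"
      using fin ne by (intro Max_in) simp_all
    then obtain t where t: "t \<in> pverts T" "Max ((\<lambda>t. card (\<gamma> t)) ` pverts T) = card (\<gamma> t)"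
      by blast
    have "treewidth H + 1 \<le> int (card (\<gamma> t))"
      using treewidth_le[OF assms(2) td'] t(2) by (simp add: td_width_def)
    then have "int (bramble_order G \<S>) * (treewidth H + 1) \<le> int (bramble_order G \<S> * card (\<gamma> t))"
      by (simp add: mult_left_mono)
    also have "bramble_order G \<S> * card (\<gamma> t) \<le> card (\<beta> t)"
      unfolding \<gamma>_def using td t(1)
      by (intro card_bag_ge_bramble_order[OF assms]) (auto simp: tree_decomposition_def)
    also have "card (\<beta> t) \<le> Max ((\<lambda>t. card (\<beta> t)) ` pverts T)"
      using fin t(1) by simp
    finally show ?thesis
      by (simp add: tw s td_width_def)
  qed
qed

end
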